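(* For all $w_1,w_2\in\mathfrak{H}^0$, $\overline{Z}\bigl(w_1\,\overline{*}\,w_2-w_1\,\overline{\sqcup\!\!\sqcup}\,w_2\bigr)=0$.
   Context: Let $\mathfrak{H}=\mathbb{Q}\langle x,y\rangle$ be the noncommutative polynomial ring in $x,y$, $\mathfrak{H}^1=\mathbb{Q}+\mathfrak{H}y$, $\mathfrak{H}^0=\mathbb{Q}+x\mathfrak{H}y$, and $z_k=x^{k-1}y$ ($k\ge1$); words of $\mathfrak{H}^0$ other than $1$ are $z_{k_1}\cdots z_{k_n}$ with $k_1\ge2$. The n-evaluation map $\overline{Z}:\mathfrak{H}^0\to\mathbb{R}$ is the $\mathbb{Q}$-linear map with $\overline{Z}(1)=1$ and $\overline{Z}(z_{k_1}\cdots z_{k_n})=\overline{\zeta}(k_1,\ldots,k_n)=\sum_{m_1\ge\cdots\ge m_n>0}m_1^{-k_1}\cdots m_n^{-k_n}$. The n-harmonic product $\overline{*}$ on $\mathfrak{H}^1$ is the $\mathbb{Q}$-bilinear product defined inductively by $1\,\overline{*}\,w=w\,\overline{*}\,1=w$ and $z_kw_1\,\overline{*}\,z_lw_2=z_k(w_1\,\overline{*}\,z_lw_2)+z_l(z_kw_1\,\overline{*}\,w_2)-z_{k+l}(w_1\,\overline{*}\,w_2)$ for words $w,w_1,w_2\in\mathfrak{H}^1$, $k,l\ge1$. The n-shuffle product $\overline{\sqcup\!\!\sqcup}$ on $\mathfrak{H}$ is the $\mathbb{Q}$-bilinear product defined inductively by $1\,\overline{\sqcup\!\!\sqcup}\,w=w\,\overline{\sqcup\!\!\sqcup}\,1=w$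 and $u_1w_1\,\overline{\sqcup\!\!\sqcup}\,u_2w_2=u_1(w_1\,\overline{\sqcup\!\!\sqcup}\,u_2w_2)+u_2(u_1w_1\,\overline{\sqcup\!\!\sqcup}\,w_2)-\delta(w_1)\tau(u_1)u_2w_2-\delta(w_2)\tau(u_2)u_1w_1$ for $u_1,u_2\in\{x,y\}$ and words $w,w_1,w_2\in\mathfrak{H}$, where $\delta(w)=1$ if $w=1$ and $0$ otherwise, and $\tau(x)=y$, $\tau(y)=x$. *)

theory Defs
  imports "HOL-Analysis.Analysis" "HOL-Library.Poly_Mapping"
begin

section \<open>The noncommutative polynomial ring\<close>

datatype letter = LX | LY

text \<open>
  Words under concatenation form the free monoid. It is written additively here, because
  \<open>'a \<Rightarrow>\<^sub>0 'b\<close> with its convolution product is a ring for an additive exponent monoid \<open>'a\<close>;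
  the resulting ring on \<open>letter list \<Rightarrow>\<^sub>0 rat\<close> is the free associative algebra over the
  rationals on two generators.
\<close>

instantiation list :: (type) monoid_add
begin

definition zero_list :: "'a list" where "zero_list = []"

definition plus_list :: "'a list \<Rightarrow> 'a list \<Rightarrow> 'a list" where "plus_list = (@)"

instance
  by standard (simp_all add: zero_list_def plus_list_def)

end

type_synonym ncpoly = "letter list \<Rightarrow>\<^sub>0 rat"

definition scalar :: "rat \<Rightarrow> ncpoly" where
  "scalar c = Poly_Mapping.single [] c"

definition word_poly :: "letter list \<Rightarrow> ncpoly" where
  "word_poly w = Poly_Mapping.single w 1"

definition var :: "letter \<Rightarrow> ncpoly" where
  "var u = word_poly [u]"

definition H1 :: "ncpoly set" where
  "H1 = {scalar c + h * var LY | c h. True}"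

definition H0 :: "ncpoly set" where
  "H0 = {scalar c + var LX * h * var LY | c h. True}"

definition linear_ext :: "(letter list \<Rightarrow> real) \<Rightarrow> ncpoly \<Rightarrow> real" where
  "linear_ext f p = (\<Sum>w\<in>Poly_Mapping.keys p. of_rat (Poly_Mapping.lookup p w) * f w)"

definition bilinear_ext ::
    "(letter list \<Rightarrow> letter list \<Rightarrow> ncpoly) \<Rightarrow> ncpoly \<Rightarrow> ncpoly \<Rightarrow> ncpoly" where
  "bilinear_ext f p q =
     (\<Sum>v\<in>Poly_Mapping.keys p. \<Sum>w\<in>Poly_Mapping.keys q.
        scalar (Poly_Mapping.lookup p v * Poly_Mapping.lookup q w) * f v w)"

section \<open>Words as sequences of indices\<close>

text \<open>Only used for \<open>k \<ge> 1\<close>.\<close>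

definition zgen :: "nat \<Rightarrow> ncpoly" where
  "zgen k = var LX ^ (k - 1) * var LY"

text \<open>
  The index sequence \<open>[k\<^sub>1, \<dots>, k\<^sub>n]\<close> of the word \<open>zgen k\<^sub>1 \<cdots> zgen k\<^sub>n\<close>. On words ending in
  \<open>LX\<close>, which do not lie in \<open>H1\<close>, the value is meaningless (trailing \<open>LX\<close>s are dropped).
\<close>

fun indices :: "letter list \<Rightarrow> nat list" where
  "indices [] = []"
| "indices (LY # w) = 1 # indices w"
| "indices (LX # w) = (case indices w of [] \<Rightarrow> [] | k # ks \<Rightarrow> Suc k # ks)"

section \<open>The n-evaluation map\<close>

text \<open>
  For the empty sequence of indices the sum is the single empty product, so \<open>zeta_bar [] = 1\<close>.
  The sum converges when \<open>k\<^sub>1 \<ge> 2\<close> and all other \<open>k\<^sub>i \<ge> 1\<close>, that is, for the words of \<open>H0\<close>.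
\<close>

definition zeta_bar :: "nat list \<Rightarrow> real" where
  "zeta_bar ks =
     (\<Sum>\<^sub>\<infinity>ms\<in>{ms :: nat list. length ms = length ks \<and> sorted_wrt (\<ge>) ms \<and> (\<forall>m\<in>set ms. m > 0)}.
        \<Prod>i<length ks. 1 / real (ms ! i) ^ (ks ! i))"

text \<open>Meaningful on \<open>H0\<close> only.\<close>

definition Z_bar :: "ncpoly \<Rightarrow> real" where
  "Z_bar = linear_ext (\<lambda>w. zeta_bar (indices w))"

section \<open>The n-harmonic product\<close>

fun nharmonic_idx :: "nat list \<Rightarrow> nat list \<Rightarrow> ncpoly" where
  "nharmonic_idx [] ls = prod_list (map zgen ls)"
| "nharmonic_idx (k # ks) [] = prod_list (map zgen (k # ks))"
| "nharmonic_idx (k # ks) (l # ls) =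
     zgen k * nharmonic_idx ks (l # ls) + zgen l * nharmonic_idx (k # ks) ls
     - zgen (k + l) * nharmonic_idx ks ls"

text \<open>Meaningful on \<open>H1\<close> only; see \<open>nharmonic_1\<close> and \<open>nharmonic_z\<close> below.\<close>

definition nharmonic :: "ncpoly \<Rightarrow> ncpoly \<Rightarrow> ncpoly" where
  "nharmonic = bilinear_ext (\<lambda>v w. nharmonic_idx (indices v) (indices w))"

section \<open>The n-shuffle product\<close>

fun tau :: "letter \<Rightarrow> letter" where
  "tau LX = LY"
| "tau LY = LX"

definition delta :: "letter list \<Rightarrow> rat" where
  "delta w = (if w = [] then 1 else 0)"

fun nshuffle_word :: "letter list \<Rightarrow> letter list \<Rightarrow> ncpoly" where
  "nshuffle_word [] w = word_poly w"
| "nshuffle_word (u # v) [] = word_poly (u # v)"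
| "nshuffle_word (u1 # w1) (u2 # w2) =
     var u1 * nshuffle_word w1 (u2 # w2) + var u2 * nshuffle_word (u1 # w1) w2
     - scalar (delta w1) * var (tau u1) * var u2 * word_poly w2
     - scalar (delta w2) * var (tau u2) * var u1 * word_poly w1"

definition nshuffle :: "ncpoly \<Rightarrow> ncpoly \<Rightarrow> ncpoly" where
  "nshuffle = bilinear_ext nshuffle_word"

section \<open>The defining properties, stated on words\<close>

lemma scalar_1 [simp]: "scalar 1 = 1"
  by (simp add: scalar_def single_one flip: zero_list_def)

lemma scalar_0 [simp]: "scalar 0 = 0"
  by (simp add: scalar_def)

lemma word_poly_Nil: "word_poly [] = 1"
  by (simp add: word_poly_def single_one flip: zero_list_def)

lemma word_poly_append: "word_poly (v @ w) = word_poly v * word_poly w"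
  by (simp add: word_poly_def mult_single plus_list_def)

lemma word_poly_Cons: "word_poly (u # w) = var u * word_poly w"
  using word_poly_append[of "[u]" w] by (simp add: var_def)

lemma word_poly_replicate: "word_poly (replicate n u) = var u ^ n"
  by (induction n) (simp_all add: word_poly_Nil word_poly_Cons)

lemma linear_ext_word_poly: "linear_ext f (word_poly w) = f w"
  by (simp add: linear_ext_def word_poly_def)

lemma bilinear_ext_word_poly: "bilinear_ext f (word_poly v) (word_poly w) = f v w"
  by (simp add: bilinear_ext_def word_poly_def)

definition zword :: "nat list \<Rightarrow> letter list" where
  "zword ks = concat (map (\<lambda>k. replicate (k - 1) LX @ [LY]) ks)"

lemma word_poly_zword: "word_poly (zword ks) = prod_list (map zgen ks)"
  by (induction ks)
    (simp_all add: zword_def word_poly_Nil word_poly_append word_poly_Cons word_poly_replicate zgen_def mult.assoc)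

lemma indices_replicate: "indices (replicate n LX @ LY # w) = Suc n # indices w"
  by (induction n) simp_all

lemma indices_zword: "\<forall>k\<in>set ks. k \<ge> 1 \<Longrightarrow> indices (zword ks) = ks"
  by (induction ks) (simp_all add: zword_def indices_replicate)

lemma indices_pos: "k \<in> set (indices w) \<Longrightarrow> k \<ge> 1"
proof (induction w arbitrary: k rule: indices.induct)
  case (3 w)
  then show ?case by (cases "indices w") auto
qed auto

lemma zword_indices: "w = [] \<or> last w = LY \<Longrightarrow> zword (indices w) = w"
proof (induction w rule: indices.induct)
  case (3 w)
  then have w: "w \<noteq> []" "zword (indices w) = w"
    by (auto split: if_splits)
  then obtain k ks where k: "indices w = k # ks"
    by (cases "indices w") (auto simp: zword_def)
  have "k \<ge> 1"
    using k indices_pos[of k w] by simp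
  then show ?case
    using w k by (cases k) (auto simp: zword_def)
qed (auto simp: zword_def split: if_splits)

lemma Z_bar_zword:
  assumes "\<forall>k\<in>set ks. k \<ge> 1"
  shows "Z_bar (prod_list (map zgen ks)) = zeta_bar ks"
  using assms by (simp add: Z_bar_def linear_ext_word_poly indices_zword flip: word_poly_zword)

lemma Z_bar_1: "Z_bar 1 = 1"
proof -
  have "{ms :: nat list. length ms = length [] \<and> sorted_wrt (\<ge>) ms \<and> (\<forall>m\<in>set ms. m > 0)} = {[]}"
    by auto
  then have "zeta_bar [] = 1"
    unfolding zeta_bar_def by simp
  then show ?thesis
    using Z_bar_zword[of "[]"] by simp
qed

lemma nharmonic_zword:
  assumes "\<forall>k\<in>set ks. k \<ge> 1" "\<forall>l\<in>set ls. l \<ge> 1"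
  shows "nharmonic (prod_list (map zgen ks)) (prod_list (map zgen ls)) = nharmonic_idx ks ls"
  using assms by (simp add: nharmonic_def bilinear_ext_word_poly indices_zword flip: word_poly_zword)

lemma nharmonic_1:
  assumes "w = [] \<or> last w = LY"
  shows "nharmonic 1 (word_poly w) = word_poly w" "nharmonic (word_poly w) 1 = word_poly w"
proof -
  have "nharmonic_idx (indices w) [] = prod_list (map zgen (indices w))"
    by (cases "indices w") simp_all
  then show "nharmonic 1 (word_poly w) = word_poly w" "nharmonic (word_poly w) 1 = word_poly w"
    using assms
    by (simp_all add: nharmonic_def bilinear_ext_word_poly zword_indices
        flip: word_poly_Nil word_poly_zword)
qed

lemma nharmonic_z:
  assumes v: "v = [] \<or> last v = LY" and w: "w = [] \<or> last w = LY" and kl: "k \<ge> 1" "l \<ge> 1"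
  shows "nharmonic (zgen k * word_poly v) (zgen l * word_poly w) =
    zgen k * nharmonic (word_poly v) (zgen l * word_poly w) + zgen l * nharmonic (zgen k * word_poly v) (word_poly w)
    - zgen (k + l) * nharmonic (word_poly v) (word_poly w)"
proof -
  have eq: "word_poly u = prod_list (map zgen (indices u))" if "u = [] \<or> last u = LY" for u
    using that by (simp add: zword_indices flip: word_poly_zword)
  have pos: "\<forall>i\<in>set (indices u). i \<ge> 1" for u
    using indices_pos by blast
  have cons: "zgen i * prod_list (map zgen is) = prod_list (map zgen (i # is))" for i "is"
    by simp
  show ?thesis
    unfolding eq[OF v] eq[OF w] cons using kl pos[of v] pos[of w]
    by (simp only: nharmonic_zword nharmonic_idx.simps list.set ball_simps simp_thms)
qed

lemma nshuffle_1: "nshuffle 1 (word_poly w) = word_poly w" "nshuffle (word_poly w) 1 = word_poly w"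
proof -
  have "nshuffle_word w [] = word_poly w"
    by (cases w) simp_all
  then show "nshuffle 1 (word_poly w) = word_poly w" "nshuffle (word_poly w) 1 = word_poly w"
    by (simp_all add: nshuffle_def bilinear_ext_word_poly flip: word_poly_Nil)
qed

lemma nshuffle_var:
  "nshuffle (var u1 * word_poly w1) (var u2 * word_poly w2) =
     var u1 * nshuffle (word_poly w1) (var u2 * word_poly w2) + var u2 * nshuffle (var u1 * word_poly w1) (word_poly w2)
     - scalar (delta w1) * var (tau u1) * var u2 * word_poly w2
     - scalar (delta w2) * var (tau u2) * var u1 * word_poly w1"
  by (simp only: nshuffle_def bilinear_ext_word_poly nshuffle_word.simps flip: word_poly_Cons)

end

theory Submission
  imports Defs
begin

text \<open>
  Both products are sent by \<open>Z_bar\<close> to the product of real numbers. For the n-harmonic product this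
  already holds for the sums truncated at \<open>m\<^sub>1 \<le> N\<close>. For the n-shuffle product it holds for the
  generating functions \<open>L w = (\<Sum> t ^ m\<^sub>1 / (m\<^sub>1 ^ k\<^sub>1 \<cdots> m\<^sub>n ^ k\<^sub>n))\<close>: the product rule for
  \<open>t d/dt\<close> is the recursion of the n-shuffle product. Letting \<open>N\<close> tend to infinity, respectively
  evaluating the Cauchy product at \<open>t = 1\<close>, gives the claim.
\<close>

section \<open>Linear extensions\<close>

lemma linear_ext_superset:
  assumes "finite A" "Poly_Mapping.keys p \<subseteq> A"
  shows "linear_ext f p = (\<Sum>w\<in>A. of_rat (Poly_Mapping.lookup p w) * f w)"
  unfolding linear_ext_def
  using assms by (intro sum.mono_neutral_left) (auto simp: in_keys_iff)

lemma linear_ext_zero [simp]: "linear_ext f 0 = 0"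
  by (simp add: linear_ext_def)

lemma linear_ext_add: "linear_ext f (p + q) = linear_ext f p + linear_ext f q"
proof -
  have fin: "finite (Poly_Mapping.keys p \<union> Poly_Mapping.keys q)"
    by simp
  show ?thesis
    using keys_add[of p q]
    by (simp add: linear_ext_superset[OF fin] lookup_add of_rat_add ring_distribs sum.distrib)
qed

lemma linear_ext_diff: "linear_ext f (p - q) = linear_ext f p - linear_ext f q"
  using linear_ext_add[of f "p - q" q] by simp

lemma linear_ext_sum: "linear_ext f (sum p A) = (\<Sum>i\<in>A. linear_ext f (p i))"
  by (induction A rule: infinite_finite_induct) (simp_all add: linear_ext_add)

lemma linear_ext_single: "linear_ext f (Poly_Mapping.single w c) = of_rat c * f w"
  by (cases "c = 0") (simp_all add: linear_ext_def)

lemma ncpoly_eq_sum_single: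
  "(p :: ncpoly) = (\<Sum>w\<in>Poly_Mapping.keys p. Poly_Mapping.single w (Poly_Mapping.lookup p w))"
proof (rule poly_mapping_eqI)
  fix v
  show "Poly_Mapping.lookup p v = Poly_Mapping.lookup
      (\<Sum>w\<in>Poly_Mapping.keys p. Poly_Mapping.single w (Poly_Mapping.lookup p w)) v"
    by (simp add: lookup_sum lookup_single when_def in_keys_iff)
qed

text \<open>Expanding \<open>p\<close> into monomials first leaves only linearity to apply, so the
  support of the product need not be known.\<close>

lemma linear_ext_single_mult:
  "linear_ext f (Poly_Mapping.single v c * p) = of_rat c * linear_ext (\<lambda>w. f (v @ w)) p"
proof -
  have "linear_ext f (Poly_Mapping.single v c * p) =
      linear_ext f (\<Sum>w\<in>Poly_Mapping.keys p. Poly_Mapping.single (v @ w) (c * Poly_Mapping.lookup p w))"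
    by (subst ncpoly_eq_sum_single[of p])
      (simp add: sum_distrib_left mult_single plus_list_def)
  also have "\<dots> = of_rat c * linear_ext (\<lambda>w. f (v @ w)) p"
    by (simp add: linear_ext_sum linear_ext_single, simp add: linear_ext_def sum_distrib_left of_rat_mult mult.assoc)
  finally show ?thesis .
qed

lemma linear_ext_word_poly_mult:
  "linear_ext f (word_poly v * p) = linear_ext (\<lambda>w. f (v @ w)) p"
  by (simp add: word_poly_def linear_ext_single_mult)

lemma linear_ext_var_mult: "linear_ext f (var u * p) = linear_ext (\<lambda>w. f (u # w)) p"
  by (simp add: var_def linear_ext_word_poly_mult)

lemma linear_ext_scalar_mult: "linear_ext f (scalar c * p) = of_rat c * linear_ext f p"
  by (simp add: scalar_def linear_ext_single_mult)

lemma linear_ext_fun_cmult: "linear_ext (\<lambda>w. c * f w) p = c * linear_ext f p"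
  by (simp add: linear_ext_def sum_distrib_left mult.left_commute)

lemma linear_ext_fun_sum: "linear_ext (\<lambda>w. \<Sum>i\<in>A. f i w) p = (\<Sum>i\<in>A. linear_ext (f i) p)"
  unfolding linear_ext_def by (simp add: sum_distrib_left sum.swap[of _ A])

lemma linear_ext_cong:
  "(\<And>w. w \<in> Poly_Mapping.keys p \<Longrightarrow> f w = g w) \<Longrightarrow> linear_ext f p = linear_ext g p"
  by (simp add: linear_ext_def)

lemma linear_ext_tendsto:
  assumes "\<And>w. w \<in> Poly_Mapping.keys p \<Longrightarrow> (\<lambda>N. f N w) \<longlonglongrightarrow> g w"
  shows "(\<lambda>N. linear_ext (f N) p) \<longlonglongrightarrow> linear_ext g p"
  unfolding linear_ext_def using assms by (intro tendsto_intros)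

text \<open>Reduces multiplicativity on polynomials to words. The hypothesis is confined to the
  supports because the word identities below concern only words of suitable shape.\<close>

lemma linear_ext_bilinear_ext:
  assumes "\<And>v w. v \<in> Poly_Mapping.keys p \<Longrightarrow> w \<in> Poly_Mapping.keys q \<Longrightarrow>
    linear_ext f (g v w) = f v * f w"
  shows "linear_ext f (bilinear_ext g p q) = linear_ext f p * linear_ext f q"
proof -
  have "linear_ext f (bilinear_ext g p q) =
    (\<Sum>v\<in>Poly_Mapping.keys p. \<Sum>w\<in>Poly_Mapping.keys q.
      of_rat (Poly_Mapping.lookup p v * Poly_Mapping.lookup q w) * (f v * f w))"
    unfolding bilinear_ext_def
    by (simp add: linear_ext_sum linear_ext_scalar_mult assms)
  also have "\<dots> = linear_ext f p * linear_ext f q"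
    by (simp add: linear_ext_def sum_product of_rat_mult mult_ac)
  finally show ?thesis .
qed

section \<open>Supports\<close>

lemma keys_mult_append:
  fixes p q :: ncpoly
  shows "Poly_Mapping.keys (p * q) \<subseteq>
    {v @ w | v w. v \<in> Poly_Mapping.keys p \<and> w \<in> Poly_Mapping.keys q}"
  using keys_mult[of p q] by (simp add: plus_list_def)

lemma keys_word_poly_mult: "Poly_Mapping.keys (word_poly v * p) \<subseteq> (@) v ` Poly_Mapping.keys p"
  using keys_mult_append[of "word_poly v" p] by (auto simp: word_poly_def)

lemma keys_var_mult: "Poly_Mapping.keys (var u * p) \<subseteq> (#) u ` Poly_Mapping.keys p"
  using keys_word_poly_mult[of "[u]" p] by (auto simp: var_def)

lemma keys_mult_var: "Poly_Mapping.keys (p * var u) \<subseteq> (\<lambda>w. w @ [u]) ` Poly_Mapping.keys p"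
  using keys_mult_append[of p "var u"] by (auto simp: word_poly_def var_def)

lemma keys_scalar_mult: "Poly_Mapping.keys (scalar c * p) \<subseteq> Poly_Mapping.keys p"
  using keys_mult_append[of "scalar c" p] by (auto simp: scalar_def split: if_splits)

text \<open>The words spanning \<open>H0\<close>. A nonempty one has at least two letters, as its
  first and last letters differ.\<close>

definition admissible :: "letter list \<Rightarrow> bool" where
  "admissible w \<longleftrightarrow> w = [] \<or> hd w = LX \<and> last w = LY"

lemma keys_H0:
  assumes "p \<in> H0" "w \<in> Poly_Mapping.keys p"
  shows "admissible w"
proof -
  obtain c h where p: "p = scalar c + var LX * h * var LY"
    using assms(1) by (auto simp: H0_def)
  have "w \<in> Poly_Mapping.keys (scalar c) \<or> w \<in> Poly_Mapping.keys (var LX * (h * var LY))"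
    using assms(2) keys_add[of "scalar c" "var LX * (h * var LY)"] by (auto simp: p mult.assoc)
  then show ?thesis
  proof
    assume "w \<in> Poly_Mapping.keys (scalar c)"
    then show ?thesis
      by (auto simp: scalar_def admissible_def split: if_splits)
  next
    assume "w \<in> Poly_Mapping.keys (var LX * (h * var LY))"
    then obtain v where "w = LX # v @ [LY]"
      using keys_var_mult[of LX "h * var LY"] keys_mult_var[of h LY] by blast
    then show ?thesis
      by (simp add: admissible_def)
  qed
qed

section \<open>Truncated sums and the n-harmonic product\<close>

text \<open>Passing the summation variable on as the next bound encodes the weak inequalities
  between successive entries.\<close>

fun trunc_zeta :: "nat list \<Rightarrow> nat \<Rightarrow> real" where
  "trunc_zeta [] N = 1"
| "trunc_zeta (k # ks) N = (\<Sum>m=1..N. trunc_zeta ks m / real m ^ k)"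

text \<open>Translates a left factor in the n-harmonic recursion into an outer summation, for an
  arbitrary polynomial \<open>p\<close>.\<close>

lemma linear_ext_zgen_mult:
  assumes "k \<ge> 1"
  shows "linear_ext (\<lambda>w. trunc_zeta (indices w) N) (zgen k * p) =
    (\<Sum>m=1..N. linear_ext (\<lambda>w. trunc_zeta (indices w) m) p / real m ^ k)"
proof -
  have z: "zgen k = word_poly (replicate (k - 1) LX @ [LY])"
    by (simp add: zgen_def word_poly_append word_poly_replicate var_def)
  show ?thesis
    unfolding z linear_ext_word_poly_mult using assms
    by (simp add: indices_replicate linear_ext_fun_sum)
      (simp add: linear_ext_fun_cmult[of "1 / _", simplified])
qed

text \<open>The double sum over \<open>i, j \<le> N\<close> is split into \<open>i \<ge> j\<close> and \<open>i \<le> j\<close>; the diagonal is counted twice.\<close>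

lemma sum_mult_split:
  fixes f g :: "nat \<Rightarrow> real"
  shows "(\<Sum>i=1..N. f i) * (\<Sum>j=1..N. g j) =
    (\<Sum>m=1..N. f m * (\<Sum>j=1..m. g j)) + (\<Sum>m=1..N. g m * (\<Sum>i=1..m. f i)) - (\<Sum>m=1..N. f m * g m)"
  by (induction N) (simp_all add: algebra_simps)

lemma linear_ext_prod_zgen:
  assumes "\<forall>k\<in>set ks. k \<ge> 1"
  shows "linear_ext f (prod_list (map zgen ks)) = f (zword ks)"
  by (simp add: linear_ext_word_poly flip: word_poly_zword)

text \<open>The three sums of \<open>sum_mult_split\<close> match the three terms of the recursion;
  the diagonal yields the index \<open>k + l\<close>. The induction hypotheses are used at every
  inner bound \<open>m\<close>, hence the arbitrary \<open>N\<close>.\<close>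

lemma linear_ext_nharmonic_idx:
  assumes "\<forall>k\<in>set ks. k \<ge> 1" "\<forall>l\<in>set ls. l \<ge> 1"
  shows "linear_ext (\<lambda>w. trunc_zeta (indices w) N) (nharmonic_idx ks ls) =
    trunc_zeta ks N * trunc_zeta ls N"
  using assms
proof (induction ks ls arbitrary: N rule: nharmonic_idx.induct)
  case (1 ls)
  then show ?case
    by (simp add: linear_ext_prod_zgen indices_zword)
next
  case (2 k ks)
  then show ?case
    using linear_ext_prod_zgen[of "k # ks"] indices_zword[of "k # ks"] by simp
next
  case (3 k ks l ls)
  have "trunc_zeta (k # ks) N * trunc_zeta (l # ls) N =
      (\<Sum>m=1..N. trunc_zeta ks m / real m ^ k * trunc_zeta (l # ls) m)
      + (\<Sum>m=1..N. trunc_zeta ls m / real m ^ l * trunc_zeta (k # ks) m)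
      - (\<Sum>m=1..N. trunc_zeta ks m / real m ^ k * (trunc_zeta ls m / real m ^ l))"
    unfolding trunc_zeta.simps by (rule sum_mult_split)
  then show ?case
    using 3 by (simp add: linear_ext_add linear_ext_diff linear_ext_zgen_mult power_add mult_ac
        del: trunc_zeta.simps)
qed

text \<open>Secures convergence of the truncated sums for every word of the product: each term
  begins with an index at least 2.\<close>

lemma keys_nharmonic_idx:
  assumes "ks \<noteq> [] \<Longrightarrow> hd ks \<ge> 2" "ls \<noteq> [] \<Longrightarrow> hd ls \<ge> 2"
  shows "Poly_Mapping.keys (nharmonic_idx ks ls) \<subseteq> {w. w = [] \<or> hd w = LX}"
proof -
  have z: "Poly_Mapping.keys (zgen k * p) \<subseteq> {w. w = [] \<or> hd w = LX}" if "k \<ge> 2" for k p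
  proof -
    have "k - 1 = Suc (k - 2)"
      using that by simp
    then have "zgen k * p = var LX * (var LX ^ (k - 2) * var LY * p)"
      by (simp only: zgen_def power_Suc mult.assoc)
    then show ?thesis
      using keys_var_mult by fastforce
  qed
  have prod: "Poly_Mapping.keys (prod_list (map zgen is)) \<subseteq> {w. w = [] \<or> hd w = LX}"
    if "is \<noteq> [] \<Longrightarrow> hd is \<ge> 2" for "is"
    using that z by (cases "is") (auto simp: zero_list_def)
  have keys: "Poly_Mapping.keys (a + b - c) \<subseteq>
      Poly_Mapping.keys a \<union> Poly_Mapping.keys b \<union> Poly_Mapping.keys c" for a b c :: ncpoly
    using keys_diff[of "a + b" c] keys_add[of a b] by blast
  show ?thesis
  proof (cases "ks = [] \<or> ls = []")
    case True
    then have "nharmonic_idx ks ls = prod_list (map zgen ls) \<or> nharmonic_idx ks ls = prod_list (map zgen ks)"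
      by (cases ks) auto
    then show ?thesis
      using prod[OF assms(1)] prod[OF assms(2)] by (elim disjE ssubst)
  next
    case False
    then obtain k ks' l ls' where kl: "ks = k # ks'" "ls = l # ls'"
      by (meson neq_Nil_conv)
    have "Poly_Mapping.keys (nharmonic_idx ks ls) \<subseteq>
        Poly_Mapping.keys (zgen k * nharmonic_idx ks' ls) \<union> Poly_Mapping.keys (zgen l * nharmonic_idx ks ls')
        \<union> Poly_Mapping.keys (zgen (k + l) * nharmonic_idx ks' ls')"
      unfolding kl nharmonic_idx.simps by (rule keys)
    also have "\<dots> \<subseteq> {w. w = [] \<or> hd w = LX}"
      using assms kl by (intro Un_least z) auto
    finally show ?thesis .
  qed
qed

section \<open>Convergence\<close>

lemma trunc_zeta_nonneg: "trunc_zeta ks N \<ge> 0"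
  by (induction ks N rule: trunc_zeta.induct) (auto intro!: sum_nonneg)

text \<open>Telescoping: each summand is at most twice the increment of the square root.\<close>

lemma sum_inverse_sqrt_le: "(\<Sum>m=1..N. 1 / sqrt (real m)) \<le> 2 * sqrt (real N)"
proof (induction N)
  case (Suc N)
  let ?a = "sqrt (real (Suc N))" and ?b = "sqrt (real N)"
  have ab: "?a > 0" "?b \<ge> 0" "?b \<le> ?a"
    by simp_all
  have "1 = (?a - ?b) * (?a + ?b)"
    using square_diff_square_factored[of ?a ?b] by (simp add: mult.commute)
  also have "\<dots> \<le> (?a - ?b) * (2 * ?a)"
    using ab by (intro mult_left_mono) auto
  finally have "1 \<le> 2 * (?a - ?b) * ?a"
    by (simp only: mult_ac)
  then have "1 / ?a \<le> 2 * (?a - ?b)"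
    using ab(1) by (simp only: pos_divide_le_eq)
  then show ?case
    using Suc by simp
qed simp

text \<open>A square root bound survives the induction: division by m leaves 1/sqrt m, whose sum is
  again of order sqrt N, so each index doubles the constant. A leading index of at least 2 then
  leaves the summable bound m^(-3/2).\<close>

lemma trunc_zeta_le_sqrt:
  assumes "\<forall>k\<in>set ks. k \<ge> 1"
  shows "\<exists>C\<ge>0. \<forall>N\<ge>1. trunc_zeta ks N \<le> C * sqrt (real N)"
  using assms
proof (induction ks)
  case Nil
  then show ?case
    by (intro exI[of _ 1]) auto
next
  case (Cons k ks)
  then obtain C where C: "C \<ge> 0" "\<And>N. N \<ge> 1 \<Longrightarrow> trunc_zeta ks N \<le> C * sqrt (real N)"
    by auto
  have "trunc_zeta (k # ks) N \<le> 2 * C * sqrt (real N)" for N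
  proof -
    have "trunc_zeta ks m / real m ^ k \<le> C * (1 / sqrt (real m))" if "m \<ge> 1" for m
    proof -
      have "trunc_zeta ks m / real m ^ k \<le> C * sqrt (real m) / real m ^ 1"
        using that C Cons.prems by (intro frac_le C power_increasing) auto
      also have "\<dots> = C * (1 / sqrt (real m))"
        using that by (simp add: field_simps flip: real_sqrt_mult)
      finally show ?thesis .
    qed
    then have "trunc_zeta (k # ks) N \<le> (\<Sum>m=1..N. C * (1 / sqrt (real m)))"
      by (auto intro!: sum_mono)
    also have "\<dots> \<le> C * (2 * sqrt (real N))"
      unfolding sum_distrib_left[symmetric] by (intro mult_left_mono sum_inverse_sqrt_le C)
    finally show ?thesis
      by simp
  qed
  then show ?case
    using C(1) by (intro exI[of _ "2 * C"]) auto
qed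

text \<open>The coefficient at \<open>m\<close> collects the summands of \<open>zeta_bar ks\<close> with \<open>m\<^sub>1 = m\<close>; the empty sequence is
  assigned to \<open>m = 0\<close>. Division by zero makes the other sequences vanish at \<open>m = 0\<close>.\<close>

fun zeta_coeff :: "nat list \<Rightarrow> nat \<Rightarrow> real" where
  "zeta_coeff [] m = (if m = 0 then 1 else 0)"
| "zeta_coeff (k # ks) m = trunc_zeta ks m / real m ^ k"

lemma zeta_coeff_nonneg: "zeta_coeff ks m \<ge> 0"
  by (cases ks) (simp_all add: trunc_zeta_nonneg)

lemma sum_zeta_coeff:
  assumes "\<forall>k\<in>set ks. k \<ge> 1"
  shows "(\<Sum>m\<le>N. zeta_coeff ks m) = trunc_zeta ks N"
proof (cases ks)
  case (Cons k ks')
  have "(\<Sum>m\<le>N. zeta_coeff ks m) = (\<Sum>m=1..N. zeta_coeff ks m)"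
    using assms Cons by (intro sum.mono_neutral_right) (auto simp: not_less_eq_eq)
  then show ?thesis
    using Cons by simp
qed simp

lemma summable_zeta_coeff:
  assumes "\<forall>k\<in>set ks. k \<ge> 1" "ks \<noteq> [] \<Longrightarrow> hd ks \<ge> 2"
  shows "summable (zeta_coeff ks)"
proof (cases ks)
  case Nil
  have "zeta_coeff [] = (\<lambda>m. if m = 0 then 1 else 0)"
    by auto
  then show ?thesis
    using Nil sums_If_finite[of "\<lambda>m. m = 0" "\<lambda>_. 1::real"] by (auto simp: summable_def)
next
  case (Cons k ks')
  then obtain C where C: "C \<ge> 0" "\<And>N. N \<ge> 1 \<Longrightarrow> trunc_zeta ks' N \<le> C * sqrt (real N)"
    using trunc_zeta_le_sqrt[of ks'] assms by auto
  show ?thesis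
  proof (rule summable_comparison_test)
    show "summable (\<lambda>m. C * real m powr (- 3 / 2))"
      by (intro summable_mult) (simp add: summable_real_powr_iff)
    show "\<exists>N. \<forall>m\<ge>N. norm (zeta_coeff ks m) \<le> C * real m powr (- 3 / 2)"
    proof (intro exI[of _ 1] allI impI)
      fix m :: nat
      assume m: "m \<ge> 1"
      have "zeta_coeff ks m \<le> C * sqrt (real m) / real m ^ 2"
        using m C Cons assms by (auto intro!: frac_le C power_increasing)
      also have "sqrt (real m) / real m ^ 2 = real m powr (1 / 2 - 2)"
        using m by (simp only: powr_diff) (simp add: powr_half_sqrt)
      then have "C * sqrt (real m) / real m ^ 2 = C * real m powr (- 3 / 2)"
        by (simp flip: times_divide_eq_right)
      finally show "norm (zeta_coeff ks m) \<le> C * real m powr (- 3 / 2)"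
        using zeta_coeff_nonneg[of ks m] by simp
    qed
  qed
qed

section \<open>Truncated sums as finite pieces of the infinite sum\<close>

definition decreasing_lists :: "nat \<Rightarrow> nat list set" where
  "decreasing_lists n = {ms. length ms = n \<and> sorted_wrt (\<ge>) ms \<and> (\<forall>m\<in>set ms. m > 0)}"

text \<open>For nonempty decreasing lists this only bounds the first entry, which is the truncation
  in \<open>trunc_zeta\<close>.\<close>

definition bounded_lists :: "nat \<Rightarrow> nat \<Rightarrow> nat list set" where
  "bounded_lists n N = {ms \<in> decreasing_lists n. set ms \<subseteq> {..N}}"

lemma finite_bounded_lists: "finite (bounded_lists n N)"
  by (rule finite_subset[OF _ finite_lists_length_eq[of "{..N}" n]])
    (auto simp: bounded_lists_def decreasing_lists_def)

lemma bounded_lists_Suc: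
  "bounded_lists (Suc n) N = (\<lambda>(m, ms). m # ms) ` (SIGMA m:{1..N}. bounded_lists n m)"
proof (intro set_eqI iffI)
  fix ms
  assume ms: "ms \<in> bounded_lists (Suc n) N"
  then obtain m ms' where "ms = m # ms'"
    by (cases ms) (auto simp: bounded_lists_def decreasing_lists_def)
  then show "ms \<in> (\<lambda>(m, ms). m # ms) ` (SIGMA m:{1..N}. bounded_lists n m)"
    using ms by (auto simp: bounded_lists_def decreasing_lists_def)
qed (auto simp: bounded_lists_def decreasing_lists_def)

lemma trunc_zeta_eq_sum:
  "trunc_zeta ks N = (\<Sum>ms\<in>bounded_lists (length ks) N. \<Prod>i<length ks. 1 / real (ms ! i) ^ (ks ! i))"
proof (induction ks arbitrary: N)
  case Nil
  have "bounded_lists 0 N = {[]}"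
    by (auto simp: bounded_lists_def decreasing_lists_def)
  then show ?case
    by simp
next
  case (Cons k ks)
  have inj: "inj_on (\<lambda>x. fst x # snd x) A" for A :: "(nat \<times> nat list) set"
    by (auto simp: inj_on_def)
  show ?case
    by (simp add: bounded_lists_Suc case_prod_unfold sum.reindex[OF inj] prod.lessThan_Suc_shift
        Cons.IH sum_divide_distrib sum.Sigma finite_bounded_lists del: prod.lessThan_Suc)
qed

text \<open>Bridges the unordered sum in \<open>zeta_bar\<close> and the limit over N. The summands
  are nonnegative and every finite set of lists lies in some \<open>bounded_lists n N\<close>, so
  both equal the supremum of the finite sums.\<close>

lemma zeta_bar_eq_limit:
  assumes lim: "trunc_zeta ks \<longlonglongrightarrow> s"
  shows "zeta_bar ks = s"
proof -
  define n where "n = length ks"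
  define f where "f ms = (\<Prod>i<n. 1 / real (ms ! i) ^ (ks ! i))" for ms
  have zeta: "zeta_bar ks = infsum f (decreasing_lists n)"
    by (simp add: zeta_bar_def f_def[abs_def] n_def decreasing_lists_def)
  have f: "f ms \<ge> 0" for ms
    by (simp add: f_def prod_nonneg)
  have trunc: "trunc_zeta ks N = sum f (bounded_lists n N)" for N
    by (simp add: trunc_zeta_eq_sum f_def n_def)
  have "incseq (trunc_zeta ks)"
    unfolding trunc incseq_def
    by (auto intro!: sum_mono2 f simp: finite_bounded_lists) (auto simp: bounded_lists_def)
  then have le: "trunc_zeta ks N \<le> s" for N
    using lim incseq_le by blast
  have bound: "sum f F \<le> s" if F: "finite F" "F \<subseteq> decreasing_lists n" for F
  proof -
    have "finite (\<Union>(set ` F))"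
      using F by auto
    then obtain N where "\<Union>(set ` F) \<subseteq> {..N}"
      by (metis finite_nat_iff_bounded_le)
    then have "F \<subseteq> bounded_lists n N"
      using F by (auto simp: bounded_lists_def)
    then have "sum f F \<le> sum f (bounded_lists n N)"
      by (intro sum_mono2 finite_bounded_lists f)
    then show ?thesis
      using le[of N] trunc by simp
  qed
  have summable: "f summable_on decreasing_lists n"
    using bound f by (intro nonneg_bdd_above_summable_on) (auto intro!: bdd_aboveI[of _ s])
  have "infsum f (decreasing_lists n) \<le> s"
    using summable bound by (rule infsum_le_finite_sums)
  moreover have "trunc_zeta ks N \<le> infsum f (decreasing_lists n)" for N
    unfolding trunc using summable f
    by (intro finite_sum_le_infsum finite_bounded_lists) (auto simp: bounded_lists_def)
  then have "s \<le> infsum f (decreasing_lists n)"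
    using lim by (intro LIMSEQ_le_const2) auto
  ultimately show ?thesis
    using zeta by simp
qed

lemma zeta_coeff_sums:
  assumes "\<forall>k\<in>set ks. k \<ge> 1" "ks \<noteq> [] \<Longrightarrow> hd ks \<ge> 2"
  shows "zeta_coeff ks sums zeta_bar ks"
proof -
  have "trunc_zeta ks \<longlonglongrightarrow> suminf (zeta_coeff ks)"
    using summable_LIMSEQ'[OF summable_zeta_coeff[OF assms]] sum_zeta_coeff[OF assms(1)] by simp
  then show ?thesis
    using zeta_bar_eq_limit summable_zeta_coeff[OF assms] by (metis summable_sums)
qed

section \<open>Passage to the limit for words and polynomials\<close>

lemma indices_ge_1: "\<forall>k\<in>set (indices w). k \<ge> 1"
  using indices_pos by blast

lemma hd_indices_ge_2:
  assumes "w = [] \<or> hd w = LX" "indices w \<noteq> []"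
  shows "hd (indices w) \<ge> 2"
proof -
  obtain v where w: "w = LX # v"
    using assms by (cases w) auto
  then obtain k ks where "indices v = k # ks"
    using assms by (cases "indices v") auto
  then show ?thesis
    using w indices_pos[of k v] by auto
qed

lemma trunc_zeta_tendsto:
  assumes "w = [] \<or> hd w = LX"
  shows "trunc_zeta (indices w) \<longlonglongrightarrow> zeta_bar (indices w)"
  using zeta_coeff_sums[of "indices w"] hd_indices_ge_2[OF assms] indices_ge_1
  by (simp add: sums_def_le sum_zeta_coeff)

lemma trunc_Z_bar_tendsto:
  assumes "Poly_Mapping.keys p \<subseteq> {w. w = [] \<or> hd w = LX}"
  shows "(\<lambda>N. linear_ext (\<lambda>w. trunc_zeta (indices w) N) p) \<longlonglongrightarrow> Z_bar p"
  unfolding Z_bar_def using assms by (intro linear_ext_tendsto trunc_zeta_tendsto) auto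

lemma Z_bar_nharmonic_idx:
  assumes "v = [] \<or> hd v = LX" "w = [] \<or> hd w = LX"
  shows "Z_bar (nharmonic_idx (indices v) (indices w)) = zeta_bar (indices v) * zeta_bar (indices w)"
proof (rule LIMSEQ_unique)
  show "(\<lambda>N. linear_ext (\<lambda>w. trunc_zeta (indices w) N) (nharmonic_idx (indices v) (indices w)))
      \<longlonglongrightarrow> Z_bar (nharmonic_idx (indices v) (indices w))"
    using assms by (intro trunc_Z_bar_tendsto keys_nharmonic_idx hd_indices_ge_2)
  show "(\<lambda>N. linear_ext (\<lambda>w. trunc_zeta (indices w) N) (nharmonic_idx (indices v) (indices w)))
      \<longlonglongrightarrow> zeta_bar (indices v) * zeta_bar (indices w)"
    unfolding linear_ext_nharmonic_idx[OF indices_ge_1 indices_ge_1]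
    using assms by (intro tendsto_mult trunc_zeta_tendsto)
qed

section \<open>Generating functions and the n-shuffle product\<close>

definition theta :: "real fps \<Rightarrow> real fps" where
  "theta f = fps_X * fps_deriv f"

text \<open>Formal integration against dt/t from 0. Division by zero discards the constant term,
  which would otherwise give a logarithm.\<close>

definition theta_inv :: "real fps \<Rightarrow> real fps" where
  "theta_inv f = Abs_fps (\<lambda>n. fps_nth f n / real n)"

fun weight :: "letter \<Rightarrow> real fps" where
  "weight LX = 1"
| "weight LY = Abs_fps (\<lambda>_. 1)"

text \<open>Analytically, the letters stand for the differential forms \<open>dt/t\<close> and \<open>dt/(t(1 - t))\<close>, and
  \<open>polylog w\<close> is the iterated integral of the word \<open>w\<close>.\<close>

fun polylog :: "letter list \<Rightarrow> real fps" where
  "polylog [] = 1"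
| "polylog (u # w) = theta_inv (weight u * polylog w)"

text \<open>Defined coefficientwise, since \<open>linear_ext\<close> takes real-valued
  functions.\<close>

definition polylog_ext :: "ncpoly \<Rightarrow> real fps" where
  "polylog_ext p = Abs_fps (\<lambda>n. linear_ext (\<lambda>w. fps_nth (polylog w) n) p)"

lemma theta_nth [simp]: "fps_nth (theta f) n = real n * fps_nth f n"
  by (cases n) (simp_all add: theta_def)

lemma theta_inv_nth [simp]: "fps_nth (theta_inv f) n = fps_nth f n / real n"
  by (simp add: theta_inv_def)

lemma theta_mult: "theta (f * g) = theta f * g + f * theta g"
  by (simp add: theta_def algebra_simps)

lemma theta_theta_inv: "theta (theta_inv f) = f - fps_const (fps_nth f 0)"
  by (rule fps_ext) auto

lemma theta_eqD:
  assumes "theta f = theta g" "fps_nth f 0 = fps_nth g 0"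
  shows "f = g"
proof (rule fps_ext)
  fix n
  show "fps_nth f n = fps_nth g n"
    using assms(2) arg_cong[OF assms(1), of "\<lambda>h. fps_nth h n"] by (cases n) auto
qed

lemma weight_nth_0: "fps_nth (weight u) 0 = 1"
  by (cases u) simp_all

lemma polylog_nth_0: "fps_nth (polylog w) 0 = (if w = [] then 1 else 0)"
  by (cases w) simp_all

text \<open>The correction terms of the n-shuffle product originate here: the last letter of a word
  is \<open>LY\<close> but contributes only the form \<open>dt/(1 - t)\<close>.\<close>

lemma theta_polylog:
  assumes "last (u # w) = LY"
  shows "theta (polylog (u # w)) = weight u * polylog w - fps_const (of_rat (delta w)) * weight (tau u)"
  using assms by (cases "w = []") (simp_all add: theta_theta_inv polylog_nth_0 delta_def)

lemma polylog_ext_word_poly: "polylog_ext (word_poly w) = polylog w"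
  by (rule fps_ext) (simp add: polylog_ext_def linear_ext_word_poly)

lemma polylog_ext_add: "polylog_ext (p + q) = polylog_ext p + polylog_ext q"
  by (rule fps_ext) (simp add: polylog_ext_def linear_ext_add)

lemma polylog_ext_diff: "polylog_ext (p - q) = polylog_ext p - polylog_ext q"
  by (rule fps_ext) (simp add: polylog_ext_def linear_ext_diff)

lemma polylog_ext_scalar_mult: "polylog_ext (scalar c * p) = fps_const (of_rat c) * polylog_ext p"
  by (rule fps_ext) (simp add: polylog_ext_def linear_ext_scalar_mult)

lemma polylog_ext_var_mult: "polylog_ext (var u * p) = theta_inv (weight u * polylog_ext p)"
proof (rule fps_ext)
  fix n
  have "linear_ext (\<lambda>w. fps_nth (weight u * polylog w) n) p = fps_nth (weight u * polylog_ext p) n"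
    by (simp add: polylog_ext_def fps_mult_nth linear_ext_fun_sum linear_ext_fun_cmult)
  then show "fps_nth (polylog_ext (var u * p)) n = fps_nth (theta_inv (weight u * polylog_ext p)) n"
    using linear_ext_fun_cmult[of "1 / real n" "\<lambda>w. fps_nth (weight u * polylog w) n" p]
    by (simp add: polylog_ext_def linear_ext_var_mult)
qed

lemma theta_polylog_ext_var_mult:
  "theta (polylog_ext (var u * p)) = weight u * polylog_ext p - fps_const (fps_nth (polylog_ext p) 0)"
  by (simp add: polylog_ext_var_mult theta_theta_inv weight_nth_0)

text \<open>Both sides have constant term 0, so it suffices to compare them after
  \<open>theta\<close>. The product rule gives the two shuffle terms, and the corrections in
  \<open>theta_polylog\<close> give the two terms with \<open>delta\<close>.\<close>

lemma polylog_ext_nshuffle_word: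
  assumes "v = [] \<or> last v = LY" "w = [] \<or> last w = LY"
  shows "polylog_ext (nshuffle_word v w) = polylog v * polylog w"
  using assms
proof (induction v w rule: nshuffle_word.induct)
  case (3 u1 w1 u2 w2)
  let ?p = "nshuffle_word (u1 # w1) (u2 # w2)"
  have last: "last (u1 # w1) = LY" "last (u2 # w2) = LY"
    using 3 by auto
  have IH: "polylog_ext (nshuffle_word w1 (u2 # w2)) = polylog w1 * polylog (u2 # w2)"
    "polylog_ext (nshuffle_word (u1 # w1) w2) = polylog (u1 # w1) * polylog w2"
    using 3 by (auto split: if_splits)
  have p: "polylog_ext ?p = polylog_ext (var u1 * nshuffle_word w1 (u2 # w2))
      + polylog_ext (var u2 * nshuffle_word (u1 # w1) w2)
      - fps_const (of_rat (delta w1)) * polylog_ext (var (tau u1) * word_poly (u2 # w2))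
      - fps_const (of_rat (delta w2)) * polylog_ext (var (tau u2) * word_poly (u1 # w1))"
    by (simp add: polylog_ext_add polylog_ext_diff polylog_ext_scalar_mult mult.assoc word_poly_Cons)
  have theta_lin: "theta (f + g - fps_const a * h - fps_const b * k) =
      theta f + theta g - fps_const a * theta h - fps_const b * theta k" for f g h k a b
    by (simp add: theta_def algebra_simps)
  show ?case
  proof (rule theta_eqD)
    show "theta (polylog_ext ?p) = theta (polylog (u1 # w1) * polylog (u2 # w2))"
      unfolding p theta_lin theta_mult theta_polylog[OF last(1)] theta_polylog[OF last(2)]
        theta_polylog_ext_var_mult IH polylog_ext_word_poly
      \<comment> \<open>The constants subtracted by \<open>theta_polylog_ext_var_mult\<close>
        vanish: each series involved has a factor \<open>polylog\<close> of a nonempty word.\<close>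
      by (simp add: polylog_nth_0 algebra_simps del: polylog.simps)
    show "fps_nth (polylog_ext ?p) 0 = fps_nth (polylog (u1 # w1) * polylog (u2 # w2)) 0"
      unfolding p by (simp add: polylog_ext_var_mult)
  qed
qed (simp_all add: polylog_ext_word_poly del: polylog.simps(2))

text \<open>A leading \<open>LY\<close> multiplies by the geometric series, which forms partial
  sums, and then divides by n: a new index 1. A leading \<open>LX\<close> only divides by n, raising
  the first index.\<close>

lemma polylog_nth:
  assumes "w = [] \<or> last w = LY"
  shows "fps_nth (polylog w) n = zeta_coeff (indices w) n"
  using assms
proof (induction w arbitrary: n rule: indices.induct)
  case (2 w)
  then have "fps_nth (polylog w) i = zeta_coeff (indices w) i" for i
    by (auto split: if_splits)
  then have "fps_nth (weight LY * polylog w) n = trunc_zeta (indices w) n"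
    by (subst mult.commute) (simp add: fps_mult_nth atLeast0AtMost sum_zeta_coeff[OF indices_ge_1])
  then show ?case
    by (simp del: weight.simps)
next
  case (3 w)
  then have w: "w \<noteq> []" "last w = LY" "fps_nth (polylog w) n = zeta_coeff (indices w) n"
    by (auto split: if_splits)
  then have "indices w \<noteq> []"
    using zword_indices[of w] by (auto simp: zword_def)
  then show ?case
    using w by (cases "indices w") auto
qed simp

text \<open>Allows \<open>polylog_nth\<close> to be applied to every word of the product.\<close>

lemma keys_nshuffle_word:
  assumes "v = [] \<or> last v = LY" "w = [] \<or> last w = LY" "v \<noteq> [] \<or> w \<noteq> []"
  shows "Poly_Mapping.keys (nshuffle_word v w) \<subseteq> {x. x \<noteq> [] \<and> last x = LY}"
  using assms
proof (induction v w rule: nshuffle_word.induct)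
  case (3 u1 w1 u2 w2)
  let ?E = "{x. x \<noteq> [] \<and> last x = LY}"
  have var: "Poly_Mapping.keys (var u * p) \<subseteq> ?E" if "Poly_Mapping.keys p \<subseteq> ?E" for u p
    using that keys_var_mult[of u p] by fastforce
  have single: "Poly_Mapping.keys (word_poly (u # w)) \<subseteq> ?E" if "last (u # w) = LY" for u w
    using that by (simp add: word_poly_def)
  have scalar: "Poly_Mapping.keys (scalar c * p) \<subseteq> ?E" if "Poly_Mapping.keys p \<subseteq> ?E" for c p
    using that keys_scalar_mult[of c p] by auto
  have add: "Poly_Mapping.keys (p + q) \<subseteq> ?E" "Poly_Mapping.keys (p - q) \<subseteq> ?E"
    if "Poly_Mapping.keys p \<subseteq> ?E" "Poly_Mapping.keys q \<subseteq> ?E" for p q :: ncpoly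
    using that keys_add[of p q] keys_diff[of p q] by blast+
  have IH: "Poly_Mapping.keys (nshuffle_word w1 (u2 # w2)) \<subseteq> ?E"
    "Poly_Mapping.keys (nshuffle_word (u1 # w1) w2) \<subseteq> ?E"
    using 3 by (auto split: if_splits)
  show ?case
    unfolding nshuffle_word.simps mult.assoc word_poly_Cons[symmetric]
    using 3 by (intro add var scalar single IH) auto
qed (auto simp: word_poly_def)

text \<open>Correction terms would start with \<open>tau LX\<close>, that is \<open>LY\<close>, and
  spoil convergence; nonempty \<open>v\<close> and \<open>w\<close> make both factors
  \<open>delta\<close> vanish.\<close>

lemma keys_nshuffle_word_LX:
  assumes "v \<noteq> []" "w \<noteq> []"
  shows "Poly_Mapping.keys (nshuffle_word (LX # v) (LX # w)) \<subseteq> {x. x = [] \<or> hd x = LX}"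
proof -
  have "nshuffle_word (LX # v) (LX # w) =
      var LX * (nshuffle_word v (LX # w) + nshuffle_word (LX # v) w)"
    using assms by (simp add: delta_def distrib_left)
  then show ?thesis
    using keys_var_mult by fastforce
qed

lemma Z_bar_nshuffle_word:
  assumes "admissible v" "admissible w"
  shows "Z_bar (nshuffle_word v w) = zeta_bar (indices v) * zeta_bar (indices w)"
proof (cases "v = [] \<or> w = []")
  case True
  have "nshuffle_word v [] = word_poly v" "zeta_bar [] = 1"
    using Z_bar_1 by (cases v; simp add: Z_bar_def linear_ext_word_poly flip: word_poly_Nil)+
  then show ?thesis
    using True by (auto simp: Z_bar_def linear_ext_word_poly)
next
  case False
  let ?p = "nshuffle_word v w"
  have vw: "hd v = LX" "last v = LY" "hd w = LX" "last w = LY"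
    using assms False by (auto simp: admissible_def)
  then obtain v' w' where "v = LX # v'" "w = LX # w'"
    using False by (metis list.exhaust_sel)
  moreover have "v' \<noteq> []" "w' \<noteq> []"
    using vw calculation by auto
  ultimately have hd: "Poly_Mapping.keys ?p \<subseteq> {x. x = [] \<or> hd x = LX}"
    using keys_nshuffle_word_LX by blast
  have last: "Poly_Mapping.keys ?p \<subseteq> {x. x \<noteq> [] \<and> last x = LY}"
    using False vw by (intro keys_nshuffle_word) auto
  have sums: "zeta_coeff (indices x) sums zeta_bar (indices x)" if "hd x = LX" for x
    using that indices_ge_1 hd_indices_ge_2 by (intro zeta_coeff_sums) auto
  have coeff: "linear_ext (\<lambda>x. zeta_coeff (indices x) n) ?p =
      (\<Sum>i\<le>n. zeta_coeff (indices v) i * zeta_coeff (indices w) (n - i))" for n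
  proof -
    have "linear_ext (\<lambda>x. zeta_coeff (indices x) n) ?p = linear_ext (\<lambda>x. fps_nth (polylog x) n) ?p"
      using last by (intro linear_ext_cong) (auto simp: polylog_nth)
    also have "\<dots> = fps_nth (polylog v * polylog w) n"
      using vw by (simp add: polylog_ext_def flip: polylog_ext_nshuffle_word)
    finally show ?thesis
      using vw by (simp add: fps_mult_nth polylog_nth atLeast0AtMost)
  qed
  \<comment> \<open>Evaluation at t = 1: nonnegative coefficients make both series absolutely
    convergent, as the Cauchy product requires.\<close>
  have "(\<lambda>n. \<Sum>i\<le>n. zeta_coeff (indices v) i * zeta_coeff (indices w) (n - i)) sums
      (zeta_bar (indices v) * zeta_bar (indices w))"
    using Cauchy_product_sums[of "zeta_coeff (indices v)" "zeta_coeff (indices w)"] sums vw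
    by (simp add: zeta_coeff_nonneg sums_iff)
  then have "(\<lambda>N. \<Sum>n\<le>N. linear_ext (\<lambda>x. zeta_coeff (indices x) n) ?p) \<longlonglongrightarrow>
      zeta_bar (indices v) * zeta_bar (indices w)"
    unfolding coeff sums_def_le .
  then have "(\<lambda>N. linear_ext (\<lambda>x. trunc_zeta (indices x) N) ?p) \<longlonglongrightarrow>
      zeta_bar (indices v) * zeta_bar (indices w)"
    by (simp add: sum_zeta_coeff[OF indices_ge_1] flip: linear_ext_fun_sum)
  then show ?thesis
    using trunc_Z_bar_tendsto[OF hd] LIMSEQ_unique by blast
qed

section \<open>From words to polynomials\<close>

theorem theorem2p8:
  fixes w1 w2 :: ncpoly
  assumes "w1 \<in> H0" and "w2 \<in> H0"
  shows "Z_bar (nharmonic w1 w2 - nshuffle w1 w2) = 0"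
proof -
  have keys: "admissible v" "admissible w"
    if "v \<in> Poly_Mapping.keys w1" "w \<in> Poly_Mapping.keys w2" for v w
    using keys_H0 assms that by blast+
  have "Z_bar (nharmonic w1 w2) = Z_bar w1 * Z_bar w2"
    unfolding nharmonic_def Z_bar_def
  proof (rule linear_ext_bilinear_ext, fold Z_bar_def)
    fix v w
    assume "v \<in> Poly_Mapping.keys w1" "w \<in> Poly_Mapping.keys w2"
    then have "admissible v" "admissible w"
      by (rule keys)+
    then show "Z_bar (nharmonic_idx (indices v) (indices w)) = zeta_bar (indices v) * zeta_bar (indices w)"
      by (intro Z_bar_nharmonic_idx) (auto simp: admissible_def)
  qed
  moreover have "Z_bar (nshuffle w1 w2) = Z_bar w1 * Z_bar w2"
    unfolding nshuffle_def Z_bar_def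
    by (rule linear_ext_bilinear_ext, fold Z_bar_def) (rule Z_bar_nshuffle_word[OF keys])
  ultimately show ?thesis
    by (simp add: Z_bar_def linear_ext_diff)
qed

end
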